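(* Let $M$ be a permuting machine. Then the set of permutations that $M$ can generate is closed, and the set of permutations that $M$ can sort is closed.
   Context: A permutation of length $n\ge 0$ is an arrangement $\pi=\pi_1\pi_2\ldots\pi_n$ of $1,2,\ldots,n$ (the empty permutation of length $0$ is allowed). A permutation $\pi$ is involved in a permutation $\sigma$, written $\pi\preceq\sigma$, if $\pi$ is order isomorphic to a (not necessarily contiguous) subsequence of $\sigma$. A set $\mathcal{X}$ of permutations is closed if $\sigma\in\mathcal{X}$ and $\pi\preceq\sigma$ imply $\pi\in\mathcal{X}$. A permuting machine is a non-deterministic machine which transforms input streams (finite sequences of distinct tokens) into output streams. It is regarded as a relation "$\sigma$ can be transformed into $\tau$" between finite sequences of distinct tokens taken from an infinite alphabet containing $1,2,3,\ldots$, with the following properties: (1) if $\sigma$ can be transformed into $\tau$, then $\tau$ is a rearrangement (permutation) of the tokens of $\sigma$; (2) (obliviousness) the machine is oblivious to the values of the input tokens: if $\sigma$ can be transformed into $\tau$ and $f$ is any injective renaming of the tokens, then $f(\sigma)$ can be transformed into $f(\tau)$, where $f$ is applied token by token; (3) (hereditary property) if $\sigma$ can be transformed into $\tau$, $\sigma'$ is a subsequence of $\sigma$, and $\tau'$ is the subsequence of $\tau$ consisting of the tokens of $\sigma'$, then $\sigma'$ (presented as an input in its own right) can be transformed into $\tau'$. The machine can generate a permutation $\pi$ of length $n$ if the input $1,2,\ldots,n$ can be transformed into $\pi_1,\pi_2,\ldots,\pi_n$. It can sort $\pi$ if the input $\pi_1,\pi_2,\ldots,\pi_n$ can be transformed into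 $1,2,\ldots,n$. *)

theory Defs
  imports "HOL-Library.Sublist" "HOL-Combinatorics.Multiset_Permutations"
begin

definition perms :: "nat list set" where
  "perms = {\<pi>. \<pi> \<in> permutations_of_set {1..length \<pi>}}"

definition order_isomorphic :: "'a::linorder list \<Rightarrow> 'b::linorder list \<Rightarrow> bool" where
  "order_isomorphic xs ys \<longleftrightarrow> length xs = length ys \<and>
     (\<forall>i<length xs. \<forall>j<length xs. xs ! i < xs ! j \<longleftrightarrow> ys ! i < ys ! j)"

definition involved :: "nat list \<Rightarrow> nat list \<Rightarrow> bool"  (infix "\<preceq>" 50) where
  "\<pi> \<preceq> \<sigma> \<longleftrightarrow> (\<exists>\<rho>. subseq \<rho> \<sigma> \<and> order_isomorphic \<pi> \<rho>)"

definition closed_class :: "nat list set \<Rightarrow> bool" where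
  "closed_class X \<longleftrightarrow> X \<subseteq> perms \<and> (\<forall>\<sigma>\<in>X. \<forall>\<pi>\<in>perms. \<pi> \<preceq> \<sigma> \<longrightarrow> \<pi> \<in> X)"

text \<open>
  The alphabet is an arbitrary set \<open>A\<close> that contains the tokens 1, 2, 3, ... by way of an
  injection \<open>tok\<close> of the positive integers (so \<open>A\<close> is infinite); the value \<open>tok 0\<close> is irrelevant.
  \<open>M \<sigma> \<tau>\<close> means that \<open>\<sigma>\<close> can be transformed into \<open>\<tau>\<close>. That \<open>\<tau>\<close> also is a sequence of distinct
  tokens of \<open>A\<close> follows from \<open>rearrangement\<close>.
\<close>

locale permuting_machine =
  fixes A :: "'a set" and tok :: "nat \<Rightarrow> 'a" and M :: "'a list \<Rightarrow> 'a list \<Rightarrow> bool"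
  assumes tok_inj: "inj_on tok {1..}"
    and tok_in: "tok ` {1..} \<subseteq> A"
    and input: "M \<sigma> \<tau> \<Longrightarrow> distinct \<sigma> \<and> set \<sigma> \<subseteq> A"
    and rearrangement: "M \<sigma> \<tau> \<Longrightarrow> mset \<tau> = mset \<sigma>"
    and oblivious: "M \<sigma> \<tau> \<Longrightarrow> inj_on f (set \<sigma>) \<Longrightarrow> f ` set \<sigma> \<subseteq> A \<Longrightarrow> M (map f \<sigma>) (map f \<tau>)"
    and hereditary: "M \<sigma> \<tau> \<Longrightarrow> subseq \<sigma>' \<sigma> \<Longrightarrow> M \<sigma>' (filter (\<lambda>x. x \<in> set \<sigma>') \<tau>)"

definition generable :: "(nat \<Rightarrow> 'a) \<Rightarrow> ('a list \<Rightarrow> 'a list \<Rightarrow> bool) \<Rightarrow> nat list set" where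
  "generable tok M = {\<pi> \<in> perms. M (map tok [1..<Suc (length \<pi>)]) (map tok \<pi>)}"

definition sortable :: "(nat \<Rightarrow> 'a) \<Rightarrow> ('a list \<Rightarrow> 'a list \<Rightarrow> bool) \<Rightarrow> nat list set" where
  "sortable tok M = {\<pi> \<in> perms. M (map tok \<pi>) (map tok [1..<Suc (length \<pi>)])}"

end

theory Submission
  imports Defs
begin

text \<open>
  Let \<open>\<pi>\<close> be order isomorphic to a subsequence \<open>\<rho>\<close> of \<open>\<sigma>\<close>. The order isomorphism is an
  increasing map \<open>g\<close> on the values of \<open>\<pi>\<close> with \<open>map g \<pi> = \<rho>\<close>, and, being increasing, it sends
  the identity \<open>1, 2, ..., k\<close> to the entries of \<open>\<rho>\<close> in increasing order, which is what remains of
  \<open>1, 2, ..., n\<close> when only the values of \<open>\<rho>\<close> are kept (\<open>involved_relabelling\<close>). So keeping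
  one and the same set of tokens in the input and in the output of \<open>M\<close> restricts \<open>\<sigma>\<close> to the \<open>g\<close>-image
  of \<open>\<pi>\<close> and the long identity to the \<open>g\<close>-image of the short one.

  The hereditary property permits the restriction, and obliviousness permits undoing \<open>g\<close>; the two
  combine to \<open>transform_pattern\<close>. As that step treats input and output alike, generating (identity
  to \<open>\<sigma>\<close>) and sorting (\<open>\<sigma>\<close> to identity) are two instances of it.
\<close>

lemma set_mono_subseq: "subseq xs ys \<Longrightarrow> set xs \<subseteq> set ys"
  by (auto elim: list_emb_set)

lemma filter_subseq_distinct:
  assumes "subseq xs ys" and "distinct ys"
  shows "filter (\<lambda>y. y \<in> set xs) ys = xs"
  using assms
proof (induction rule: list_emb.induct)
  case (list_emb_Cons xs ys y)
  then have "y \<notin> set xs"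
    by (auto dest: set_mono_subseq)
  with list_emb_Cons show ?case
    by simp
next
  case (list_emb_Cons2 x y xs ys)
  then have "filter (\<lambda>z. z \<in> set (x # xs)) ys = filter (\<lambda>z. z \<in> set xs) ys"
    by (intro filter_cong) auto
  with list_emb_Cons2 show ?case
    by simp
qed simp

lemma perms_iff: "\<pi> \<in> perms \<longleftrightarrow> distinct \<pi> \<and> set \<pi> = {1..length \<pi>}"
  by (auto simp: perms_def permutations_of_set_def)

lemma order_isomorphic_distinct_obtain_map:
  fixes xs :: "'a::linorder list" and ys :: "'b::linorder list"
  assumes "order_isomorphic xs ys" and "distinct xs"
  obtains g where "strict_mono_on (set xs) g" and "map g xs = ys"
proof
  define g where "g x = the (map_of (zip xs ys) x)" for x
  have len: "length xs = length ys"
    using assms(1) by (simp add: order_isomorphic_def)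
  have g_nth: "g (xs ! i) = ys ! i" if "i < length xs" for i
    using that assms(2) len by (simp add: g_def map_of_zip_nth)
  show "map g xs = ys"
    using len g_nth by (simp add: list_eq_iff_nth_eq)
  show "strict_mono_on (set xs) g"
    using assms(1) g_nth
    by (intro strict_mono_onI) (auto simp: in_set_conv_nth order_isomorphic_def)
qed

text \<open>
  The equation for \<open>map g [1..<Suc (length \<pi>)]\<close> holds because both sides list the values of the
  subsequence in strictly increasing order.
\<close>

lemma involved_relabelling:
  assumes "\<sigma> \<in> perms" and "\<pi> \<in> perms" and "\<pi> \<preceq> \<sigma>"
  obtains g where "inj_on g (set \<pi>)" and "subseq (map g \<pi>) \<sigma>"
    and "map g [1..<Suc (length \<pi>)]
      = filter (\<lambda>x. x \<in> set (map g \<pi>)) [1..<Suc (length \<sigma>)]"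
proof -
  obtain \<rho> where \<rho>: "subseq \<rho> \<sigma>" "order_isomorphic \<pi> \<rho>"
    using assms(3) by (auto simp: involved_def)
  have \<pi>: "distinct \<pi>" "set \<pi> = {1..length \<pi>}" and \<sigma>: "set \<sigma> = {1..length \<sigma>}"
    using assms(1,2) unfolding perms_iff by auto
  obtain g where mono: "strict_mono_on (set \<pi>) g" and g: "map g \<pi> = \<rho>"
    using order_isomorphic_distinct_obtain_map[OF \<rho>(2) \<pi>(1)] .
  have upt: "set [1..<Suc (length \<pi>)] = set \<pi>"
    by (subst \<pi>(2)) auto
  have inj: "inj_on g (set \<pi>)"
    using mono by (rule strict_mono_on_imp_inj_on)
  have "map g [1..<Suc (length \<pi>)] = filter (\<lambda>x. x \<in> set (map g \<pi>)) [1..<Suc (length \<sigma>)]"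
  proof (rule sorted_distinct_set_unique)
    show "sorted (map g [1..<Suc (length \<pi>)])"
    proof (rule sorted_map_mono)
      show "mono_on (set [1..<Suc (length \<pi>)]) g"
        unfolding upt using mono by (rule strict_mono_on_imp_mono_on)
    qed (rule sorted_upt)
    show "distinct (map g [1..<Suc (length \<pi>)])"
      unfolding distinct_map upt using inj by (simp del: upt_Suc)
    have "set (map g \<pi>) \<subseteq> {1..length \<sigma>}"
      using \<rho>(1) g \<sigma> by (metis set_mono_subseq)
    then have "set (filter (\<lambda>x. x \<in> set (map g \<pi>)) [1..<Suc (length \<sigma>)]) = g ` set \<pi>"
      by (auto simp: less_Suc_eq_le simp del: upt_Suc)
    then show "set (map g [1..<Suc (length \<pi>)])
        = set (filter (\<lambda>x. x \<in> set (map g \<pi>)) [1..<Suc (length \<sigma>)])"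
      using upt by (simp only: set_map)
  qed (auto simp del: upt_Suc intro: sorted_wrt_filter)
  with that[OF inj] \<rho>(1) g show thesis
    by blast
qed

context permuting_machine
begin

text \<open>
  Obliviousness in a form that also undoes a renaming \<open>u\<close>: the renaming to apply to the tokens is
  \<open>v\<close> composed with an inverse of \<open>u\<close>.
\<close>

lemma relabel:
  assumes "M (map u xs) (map u ys)" and "set ys = set xs"
    and "inj_on u (set xs)" and "inj_on v (set xs)" and "v ` set xs \<subseteq> A"
  shows "M (map v xs) (map v ys)"
proof -
  define f where "f = v \<circ> inv_into (set xs) u"
  have f: "f (u x) = v x" if "x \<in> set xs" for x
    using that assms(3) by (simp add: f_def)
  have "inj_on f (set (map u xs))"
    using assms(4) f by (auto simp: inj_on_def)
  moreover have "f ` set (map u xs) \<subseteq> A"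
    using assms(5) f by auto
  ultimately have "M (map f (map u xs)) (map f (map u ys))"
    by (rule oblivious[OF assms(1)])
  moreover have "map f (map u xs) = map v xs" "map f (map u ys) = map v ys"
    using f assms(2) by auto
  ultimately show ?thesis
    by (simp only:)
qed

text \<open>
  Restricting the run from \<open>s\<close> to \<open>t\<close> to the tokens of \<open>map g xs\<close> leaves a run from \<open>map g xs\<close> to
  \<open>map g ys\<close>, and the machine cannot tell this from a run on \<open>xs\<close> itself. The entries are required
  to be positive because \<open>tok\<close> is known to be injective only there: otherwise keeping the token of one
  number could keep that of another.
\<close>

lemma transform_pattern:
  assumes M: "M (map tok s) (map tok t)"
    and pos: "set s \<subseteq> {1..}" "set t \<subseteq> {1..}" "set xs \<subseteq> {1..}"
    and sets: "set ys = set xs"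
    and g: "inj_on g (set xs)" "subseq (map g xs) s"
      "map g ys = filter (\<lambda>z. z \<in> set (map g xs)) t"
  shows "M (map tok xs) (map tok ys)"
proof -
  have gpos: "g ` set xs \<subseteq> {1..}"
    using set_mono_subseq[OF g(2)] pos(1) by auto
  have mem: "tok z \<in> set (map tok (map g xs)) \<longleftrightarrow> z \<in> set (map g xs)" if "z \<in> set t" for z
    using that pos(2) gpos inj_on_image_mem_iff[OF tok_inj, of z "g ` set xs"]
    by (auto simp: image_image)
  have "M (map tok (map g xs)) (filter (\<lambda>a. a \<in> set (map tok (map g xs))) (map tok t))"
    using g(2) by (intro hereditary[OF M] subseq_map)
  also have "filter (\<lambda>a. a \<in> set (map tok (map g xs))) (map tok t) = map tok (map g ys)"
    unfolding g(3) filter_map o_def using mem by (intro arg_cong[where f = "map tok"] filter_cong refl)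
  finally have "M (map (tok \<circ> g) xs) (map (tok \<circ> g) ys)"
    by simp
  then show ?thesis
  proof (rule relabel)
    show "inj_on (tok \<circ> g) (set xs)"
      using g(1) gpos tok_inj by (blast intro: comp_inj_on inj_on_subset)
    show "inj_on tok (set xs)" "tok ` set xs \<subseteq> A"
      using pos(3) tok_inj tok_in by (blast intro: inj_on_subset)+
  qed (rule sets)
qed

end

theorem proposition1:
  fixes A :: "'a set" and tok :: "nat \<Rightarrow> 'a" and M :: "'a list \<Rightarrow> 'a list \<Rightarrow> bool"
  assumes "permuting_machine A tok M"
  shows "closed_class (generable tok M) \<and> closed_class (sortable tok M)"
proof -
  interpret permuting_machine A tok M
    by (fact assms)
  have upt: "set [1..<Suc (length \<pi>)] = set \<pi>" and pos: "set \<pi> \<subseteq> {1..}"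
    if "\<pi> \<in> perms" for \<pi>
  proof -
    have "set \<pi> = {1..length \<pi>}"
      using that by (simp add: perms_iff)
    then show "set [1..<Suc (length \<pi>)] = set \<pi>" "set \<pi> \<subseteq> {1..}"
      by (simp_all only: set_upt atLeastLessThanSuc_atLeastAtMost Icc_subset_Ici_iff le_refl simp_thms)
  qed
  have "M (map tok [1..<Suc (length \<pi>)]) (map tok \<pi>)"
    if \<sigma>: "\<sigma> \<in> perms" and \<pi>: "\<pi> \<in> perms" "\<pi> \<preceq> \<sigma>"
      and M: "M (map tok [1..<Suc (length \<sigma>)]) (map tok \<sigma>)" for \<sigma> \<pi>
  proof -
    obtain g where g: "inj_on g (set \<pi>)" "subseq (map g \<pi>) \<sigma>"
      "map g [1..<Suc (length \<pi>)] = filter (\<lambda>x. x \<in> set (map g \<pi>)) [1..<Suc (length \<sigma>)]"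
      using involved_relabelling[OF \<sigma> \<pi>] .
    have same: "set (map g [1..<Suc (length \<pi>)]) = set (map g \<pi>)"
      using upt[OF \<pi>(1)] by (simp only: set_map)
    show ?thesis
    proof (rule transform_pattern[OF M])
      show "inj_on g (set [1..<Suc (length \<pi>)])"
        unfolding upt[OF \<pi>(1)] by (rule g(1))
      show "subseq (map g [1..<Suc (length \<pi>)]) [1..<Suc (length \<sigma>)]"
        unfolding g(3) by (rule subseq_filter_left)
      have "distinct \<sigma>"
        using \<sigma> by (simp add: perms_iff)
      then show "map g \<pi> = filter (\<lambda>x. x \<in> set (map g [1..<Suc (length \<pi>)])) \<sigma>"
        unfolding same by (rule filter_subseq_distinct[OF g(2), symmetric])
    qed (simp_all only: upt \<sigma> \<pi>(1) pos)
  qed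
  then have generable: "closed_class (generable tok M)"
    by (auto simp add: closed_class_def generable_def simp del: upt_Suc)
  have "M (map tok \<pi>) (map tok [1..<Suc (length \<pi>)])"
    if \<sigma>: "\<sigma> \<in> perms" and \<pi>: "\<pi> \<in> perms" "\<pi> \<preceq> \<sigma>"
      and M: "M (map tok \<sigma>) (map tok [1..<Suc (length \<sigma>)])" for \<sigma> \<pi>
  proof -
    obtain g where g: "inj_on g (set \<pi>)" "subseq (map g \<pi>) \<sigma>"
      "map g [1..<Suc (length \<pi>)] = filter (\<lambda>x. x \<in> set (map g \<pi>)) [1..<Suc (length \<sigma>)]"
      using involved_relabelling[OF \<sigma> \<pi>] .
    show ?thesis
      by (rule transform_pattern[OF M _ _ _ _ g]) (simp_all only: upt \<sigma> \<pi>(1) pos)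
  qed
  then have "closed_class (sortable tok M)"
    by (auto simp add: closed_class_def sortable_def simp del: upt_Suc)
  with generable show ?thesis
    by blast
qed

end
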